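(* Let $a<b$ be real numbers, let $g,h:[a,b]\to\mathbb{R}$, and for $t>0$ set $$I(t)=\int_a^b e^{th(x)}g(x)\,dx.$$ Assume that $h$ attains its maximum over $[a,b]$ only at the point $x=c\in[a,b]$ (that is, $h(x)<h(c)$ for all $x\in[a,b]\setminus\{c\}$), and that $h$ is three times continuously differentiable on $[a,b]$ with $h''(c)\neq 0$. Let $k\in\mathbb{N}\cup\{0\}$ and suppose that $g$ is $(k+1)$-times continuously differentiable on $[a,b]$ with $g(c)=g'(c)=\cdots=g^{(k-1)}(c)=0$ and $g^{(k)}(c)\neq 0$ (for $k=0$ this just means $g(c)\ne 0$). Then the following hold. (I) If $a<c<b$ and, in addition, $k$ is even, then as $t\to\infty$ $$I(t)=e^{th(c)}\left(t^{-\frac12-\frac k2}\,g^{(k)}(c)\sqrt{\frac{2\pi}{|h''(c)|^{k+1}}}\;\frac{(k-1)!!}{k!}+O\!\left(t^{-1-\frac k2}\right)\right).$$ (II) If $c=a$ or $c=b$, and $h'(c)=0$, then as $t\to\infty$ $$I(t)=e^{th(c)}\left(t^{-\frac12-\frac k2}\,g^{(k)}(c)\sqrt{\frac{2^{k-1}}{|h''(c)|^{k+1}}}\;\gamma(k,c)+O\!\left(t^{-1-\frac k2}\right)\right),$$ where $$\gamma(k,c)=\begin{cases}\sqrt{\dfrac{\pi}{2^k}}\,\dfrac{(k-1)!!}{k!} & (k\text{ even}),\\[1em] \dfrac{1}{k!}\left(\dfrac{k-1}{2}\right)! & (k\text{ odd},\ c=a),\\[1em] -\dfrac{1}{k!}\left(\dfrac{k-1}{2}\right)!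 & (k\text{ odd},\ c=b).\end{cases}$$ (III) If $c=a$ or $c=b$, and $h'(c)\neq 0$, then as $t\to\infty$ $$I(t)=e^{th(c)}\left(t^{-1-k}\,g^{(k)}(c)\,(h'(c))^{-1-k}(-1)^k\,\eta(c)+O\!\left(t^{-2-k}\right)\right),$$ where $\eta(c)=-1$ if $c=a$ and $\eta(c)=1$ if $c=b$.
   Context: Derivatives of $g$ and $h$ at the endpoints $a$, $b$ are one-sided derivatives. For even $k\ge 2$, $(k-1)!!=(k-1)(k-3)\cdots 3\cdot 1$ is the double factorial, with the convention $(-1)!!=1$ (used for $k=0$). The notation $O(t^{-s})$ as $t\to\infty$ denotes a quantity bounded in absolute value by $Ct^{-s}$ for all sufficiently large $t$, where the constant $C$ may depend on $a,b,c,g,h,k$ but not on $t$. *)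

theory Defs
  imports "HOL-Analysis.Analysis" "HOL-Library.Landau_Symbols"
begin

text \<open>
  Derivatives are taken within \<open>{a..b}\<close>, hence are one-sided at \<open>a\<close> and \<open>b\<close>, and depend only on
  the values of the function on \<open>{a..b}\<close>. As usual for \<^const>\<open>vector_derivative\<close>, the value is
  meaningful only where the function is differentiable and, here, for \<open>a < b\<close> and \<open>x \<in> {a..b}\<close>.
\<close>

definition nth_deriv :: "real \<Rightarrow> real \<Rightarrow> nat \<Rightarrow> (real \<Rightarrow> real) \<Rightarrow> real \<Rightarrow> real" where
  "nth_deriv a b n f = ((\<lambda>u x. vector_derivative u (at x within {a..b})) ^^ n) f"

definition times_cont_diff :: "real \<Rightarrow> real \<Rightarrow> nat \<Rightarrow> (real \<Rightarrow> real) \<Rightarrow> bool" where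
  "times_cont_diff a b n f \<longleftrightarrow>
     (\<forall>j<n. nth_deriv a b j f differentiable_on {a..b}) \<and>
     continuous_on {a..b} (nth_deriv a b n f)"

lemma times_cont_diff_has_derivative:
  assumes "times_cont_diff a b n f" "j < n" "x \<in> {a..b}"
  shows "(nth_deriv a b j f has_real_derivative nth_deriv a b (Suc j) f x) (at x within {a..b})"
proof -
  have "nth_deriv a b j f differentiable (at x within {a..b})"
    using assms by (auto simp: times_cont_diff_def differentiable_on_def)
  then show ?thesis
    by (simp add: nth_deriv_def has_real_derivative_iff_has_vector_derivative
        vector_derivative_works)
qed

text \<open>
  The product of \<open>m, m - 2, m - 4, \<dots>\<close> down to the last positive factor. Integer arguments are
  used so that the convention \<open>(-1)!! = 1\<close> is the empty product.
\<close>

definition double_fact :: "int \<Rightarrow> int" where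
  "double_fact m = (\<Prod>j\<in>{j. 0 < j \<and> j \<le> m \<and> even (m - j)}. j)"

lemma double_fact_minus_one: "double_fact (-1) = 1"
  by (auto simp: double_fact_def intro!: prod.neutral)

lemma double_fact_rec:
  assumes "m > 0"
  shows "double_fact m = m * double_fact (m - 2)"
proof -
  let ?A = "{j. 0 < j \<and> j \<le> m - 2 \<and> even (m - 2 - j)}"
  have "finite ?A"
    by (rule finite_subset[of _ "{0..m}"]) auto
  moreover have "{j. 0 < j \<and> j \<le> m \<and> even (m - j)} = insert m ?A"
    using assms by (auto; presburger)
  ultimately show ?thesis
    by (simp add: double_fact_def)
qed

definition laplace_integral ::
    "real \<Rightarrow> real \<Rightarrow> (real \<Rightarrow> real) \<Rightarrow> (real \<Rightarrow> real) \<Rightarrow> real \<Rightarrow> real" where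
  "laplace_integral a b g h t = integral {a..b} (\<lambda>x. exp (t * h x) * g x)"

text \<open>
  The following two coefficients are used only for \<open>c = a\<close> or \<open>c = b\<close>, with \<open>a < b\<close>, so
  the final \<open>else\<close> branches are the case \<open>c = b\<close>.
\<close>

definition gamma_coeff :: "real \<Rightarrow> nat \<Rightarrow> real \<Rightarrow> real" where
  "gamma_coeff a k c =
     (if even k then sqrt (pi / 2 ^ k) * (of_int (double_fact (int k - 1)) / fact k)
      else if c = a then 1 / fact k * fact ((k - 1) div 2)
      else - (1 / fact k * fact ((k - 1) div 2)))"

definition eta_coeff :: "real \<Rightarrow> real \<Rightarrow> real" where
  "eta_coeff a c = (if c = a then -1 else 1)"

end

theory Submission
  imports Defs "HOL-Probability.Distributions"
begin

text \<open>
  Splitting the integral at \<open>c\<close> and substituting \<open>x = c \<plusminus> y\<close> reduces everything to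
  \<open>\<integral>\<^sub>0\<^sup>L exp (t \<phi>(y)) G(y) dy\<close> with \<open>\<phi>(y) = -l y\<^sup>p + O(y\<^sup>p\<^sup>+\<^sup>1)\<close>, \<open>G(y) = A y\<^sup>k + O(y\<^sup>k\<^sup>+\<^sup>1)\<close> by Taylor's
  theorem, where \<open>p = 2\<close> at a critical point and \<open>p = 1\<close> otherwise. Compactness and the
  uniqueness of the maximum give \<open>\<phi>(y) \<le> -\<mu> y\<^sup>p\<close> on all of \<open>[0, L]\<close>. Hence replacing \<open>\<phi>\<close> and \<open>G\<close> by
  their leading terms and \<open>L\<close> by \<open>\<infinity>\<close> costs at most a multiple of
  \<open>\<integral>\<^sub>0\<^sup>\<infinity> (t y\<^sup>p\<^sup>+\<^sup>k\<^sup>+\<^sup>1 + y\<^sup>k\<^sup>+\<^sup>1) exp (-t \<mu> y\<^sup>p) dy\<close>, which scales exactly like \<open>t\<close> to the power \<open>-(k+2)/p\<close>.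
  The leading term is a moment of \<open>exp (-u\<^sup>p)\<close>, known in closed form for \<open>p = 1, 2\<close>.
\<close>

section \<open>Moments of \<open>exp (- (u ^ p))\<close> on the half-line\<close>

text \<open>For \<open>p \<ge> 1\<close> this is Gamma((m + 1)/p)/p. It stays an integral because
  the error bounds only need it to be finite; values enter for \<open>p = 1\<close> and
  \<open>p = 2\<close> alone.\<close>

definition half_line_moment :: "nat \<Rightarrow> nat \<Rightarrow> real" where
  "half_line_moment p m = (LINT u:{0..}|lborel. u ^ m * exp (- (u ^ p)))"

text \<open>Yields \<open>exp (- (u ^ p)) \<le> exp 1 * exp (- u)\<close>, so that the moments of
  \<open>exp (- u)\<close> dominate those for every \<open>p \<ge> 1\<close>.\<close>

lemma power_ge_diff_one:
  fixes u :: real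
  assumes "p \<ge> 1" "u \<ge> 0"
  shows "u - 1 \<le> u ^ p"
proof (cases "u \<ge> 1")
  case True
  then have "u ^ 1 \<le> u ^ p"
    using assms(1) by (intro power_increasing)
  then show ?thesis by simp
next
  case False
  moreover have "0 \<le> u ^ p"
    using assms(2) by simp
  ultimately show ?thesis by linarith
qed

lemma has_bochner_integral_power_times_exp:
  "has_bochner_integral lborel (\<lambda>u::real. indicator {0..} u *\<^sub>R (u ^ m * exp (- u))) (fact m)"
proof (rule has_bochner_integral_nn_integral)
  have "(\<integral>\<^sup>+ u. ennreal (indicator {0..} u *\<^sub>R (u ^ m * exp (- u))) \<partial>lborel)
      = (\<integral>\<^sup>+ u. ennreal (u ^ m * exp (- u)) * indicator {0..} u \<partial>lborel)"
    by (intro nn_integral_cong) (auto split: split_indicator)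
  then show "(\<integral>\<^sup>+ u. ennreal (indicator {0..} u *\<^sub>R (u ^ m * exp (- u))) \<partial>lborel) = ennreal (fact m)"
    by (simp add: nn_intergal_power_times_exp_Ici)
qed (auto split: split_indicator)

lemma set_integrable_power_times_exp_power:
  assumes "p \<ge> 1"
  shows "set_integrable lborel {0..} (\<lambda>u::real. u ^ m * exp (- (u ^ p)))"
proof -
  have *: "integrable lborel (\<lambda>u::real. exp 1 * (indicator {0..} u *\<^sub>R (u ^ m * exp (- u))))"
    using has_bochner_integral_power_times_exp[of m]
    by (intro integrable_mult_right) (auto simp: has_bochner_integral_iff)
  show ?thesis
    unfolding set_integrable_def
  proof (rule Bochner_Integration.integrable_bound[OF *])
    show "AE u in lborel. norm (indicator {0..} u *\<^sub>R (u ^ m * exp (- (u ^ p))))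
        \<le> norm (exp 1 * (indicator {0..} u *\<^sub>R (u ^ m * exp (- u))) :: real)"
    proof (intro AE_I2)
      fix u :: real
      have "u ^ m * exp (- (u ^ p)) \<le> u ^ m * (exp 1 * exp (- u))" if "u \<ge> 0"
        using power_ge_diff_one[OF assms that] that
        by (intro mult_left_mono) (auto simp flip: exp_add)
      then show "norm (indicator {0..} u *\<^sub>R (u ^ m * exp (- (u ^ p))))
        \<le> norm (exp 1 * (indicator {0..} u *\<^sub>R (u ^ m * exp (- u))) :: real)"
        by (auto split: split_indicator simp: abs_mult mult_ac)
    qed
  qed (auto split: split_indicator)
qed

text \<open>Substituting \<open>r * y\<close> for \<open>u\<close> with \<open>r ^ p = s\<close>
  turns \<open>u ^ p\<close> into \<open>s * y ^ p\<close>; the Jacobian \<open>r\<close> and the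
  factor \<open>r ^ m\<close> together give the power of \<open>s\<close>.\<close>

lemma has_integral_power_times_exp_power:
  assumes "p \<ge> 1" "s > 0"
  shows "((\<lambda>y::real. y ^ m * exp (- (s * y ^ p))) has_integral
            half_line_moment p m * s powr (- (real m + 1) / real p)) {0..}"
proof -
  define r where "r = s powr (1 / real p)"
  have r: "r > 0" "r ^ p = s"
    using assms by (auto simp: r_def powr_powr simp flip: powr_realpow)
  have "r * r ^ m = s powr ((real m + 1) / real p)"
    using r(1) assms(2) by (simp add: r_def powr_powr add_divide_distrib powr_add flip: powr_realpow)
  then have rm: "inverse (r * r ^ m) = s powr (- (real m + 1) / real p)"
    by (metis powr_minus minus_divide_left)
  have "has_bochner_integral lborel (\<lambda>u. indicator {0..} u *\<^sub>R (u ^ m * exp (- (u ^ p)))) (half_line_moment p m)"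
    using set_integrable_power_times_exp_power[OF assms(1), of m]
    by (simp add: has_bochner_integral_iff set_integrable_def half_line_moment_def set_lebesgue_integral_def)
  then have "has_bochner_integral lborel
      (\<lambda>y. indicator {0..} (0 + r * y) *\<^sub>R ((0 + r * y) ^ m * exp (- ((0 + r * y) ^ p))))
      (half_line_moment p m /\<^sub>R \<bar>r\<bar>)"
    by (rule lborel_has_bochner_integral_real_affine_iff[THEN iffD1, rotated]) (use r(1) in simp)
  then have "has_bochner_integral lborel
      (\<lambda>y. indicator {0..} (r * y) *\<^sub>R ((r * y) ^ m * exp (- ((r * y) ^ p)))) (half_line_moment p m / r)"
    using r(1) by (simp add: divide_inverse_commute)
  then have "has_bochner_integral lborel
      (\<lambda>y. (indicator {0..} (r * y) *\<^sub>R ((r * y) ^ m * exp (- ((r * y) ^ p)))) / r ^ m)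
      (half_line_moment p m / r / r ^ m)"
    by (intro has_bochner_integral_divide)
  also have "(\<lambda>y. (indicator {0..} (r * y) *\<^sub>R ((r * y) ^ m * exp (- ((r * y) ^ p)))) / r ^ m)
     = (\<lambda>y. if y \<in> {0..} then y ^ m * exp (- (s * y ^ p)) else 0)"
    using r by (auto simp: fun_eq_iff indicator_def zero_le_mult_iff power_mult_distrib)
  also have "half_line_moment p m / r / r ^ m = half_line_moment p m * s powr (- (real m + 1) / real p)"
    unfolding rm[symmetric] by (simp add: field_simps)
  finally have "has_bochner_integral lborel (\<lambda>y. if y \<in> {0..} then y ^ m * exp (- (s * y ^ p)) else 0)
      (half_line_moment p m * s powr (- (real m + 1) / real p))" .
  \<comment> \<open>The Lebesgue integral of the extension by zero is also its gauge integral, the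
    kind used in \<open>laplace_integral\<close>.\<close>
  then show ?thesis
    using has_integral_integral_lborel[of "\<lambda>y. if y \<in> {0..} then y ^ m * exp (- (s * y ^ p)) else 0"]
    unfolding has_bochner_integral_iff has_integral_restrict_UNIV by simp
qed

lemma half_line_moment_1: "half_line_moment 1 m = fact m"
  using has_bochner_integral_power_times_exp[of m]
  by (simp add: half_line_moment_def set_lebesgue_integral_def has_bochner_integral_iff)

lemma half_line_moment_2_even:
  "half_line_moment 2 (2 * j) = sqrt pi / 2 * (fact (2 * j) / (2 ^ (2 * j) * fact j))"
  using gaussian_moment_even_pos[of j]
  by (simp add: half_line_moment_def set_lebesgue_integral_def has_bochner_integral_iff mult.commute)

lemma half_line_moment_2_odd: "half_line_moment 2 (2 * j + 1) = fact j / 2"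
  using gaussian_moment_odd_pos[of j]
  by (simp add: half_line_moment_def set_lebesgue_integral_def has_bochner_integral_iff mult.commute)

section \<open>Consequences of a leading term \<open>- (l * y ^ p)\<close>\<close>

text \<open>The two bounds give \<open>0 \<le> (l + M * y) * y ^ p\<close>; cancel
  \<open>y ^ p\<close> and let \<open>y\<close> tend to 0 from the right. This serves for the sign
  of the leading coefficient at the maximum and, with \<open>p = 1\<close>, for Fermat's
  criterion.\<close>

lemma leading_coeff_nonneg:
  fixes \<phi> :: "real \<Rightarrow> real"
  assumes "L > 0"
    and "\<And>y. 0 < y \<Longrightarrow> y \<le> L \<Longrightarrow> \<phi> y \<le> 0"
    and "\<And>y. 0 < y \<Longrightarrow> y \<le> L \<Longrightarrow> \<bar>\<phi> y + l * y ^ p\<bar> \<le> M * y ^ (p + 1)"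
  shows "l \<ge> 0"
proof (rule tendsto_upperbound)
  show "((\<lambda>y. - (M * y)) \<longlongrightarrow> 0) (at_right 0)"
    by (auto intro!: tendsto_eq_intros)
  have "- (M * y) \<le> l" if "0 < y" "y < L" for y
  proof -
    have "0 \<le> (l + M * y) * y ^ p"
      using assms(2,3)[of y] that by (simp add: algebra_simps)
    moreover have "y ^ p > 0"
      using that by simp
    ultimately have "0 \<le> l + M * y"
      using mult_right_le_imp_le[of 0 "y ^ p" "l + M * y"] by simp
    then show ?thesis
      by linarith
  qed
  then have "\<forall>\<^sub>F y in at_right 0. - (M * y) \<le> l"
    unfolding eventually_at_right_field using assms(1) by blast
  then show "\<forall>\<^sub>F y in at_right 0. - (M * y) \<le> l" .
qed auto

text \<open>Near 0 the error uses up at most half of \<open>l * y ^ p\<close>; on the remaining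
  compact interval \<open>\<phi>\<close> has a negative maximum. With \<open>\<mu> \<le> l\<close>
  the same \<open>\<mu>\<close> also majorises the model exponential later.\<close>

lemma le_neg_power_of_leading_term:
  fixes \<phi> :: "real \<Rightarrow> real"
  assumes "L > 0" "l > 0" and cont: "continuous_on {0..L} \<phi>"
    and neg: "\<And>y. 0 < y \<Longrightarrow> y \<le> L \<Longrightarrow> \<phi> y < 0"
    and app: "\<And>y. 0 \<le> y \<Longrightarrow> y \<le> L \<Longrightarrow> \<bar>\<phi> y + l * y ^ p\<bar> \<le> M * y ^ (p + 1)"
  obtains \<mu> where "0 < \<mu>" "\<mu> \<le> l" "\<And>y. 0 \<le> y \<Longrightarrow> y \<le> L \<Longrightarrow> \<phi> y \<le> - (\<mu> * y ^ p)"
proof -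
  \<comment> \<open>\<open>M'\<close> makes the division safe whatever the sign of \<open>M\<close>;
    for \<open>0 \<le> y \<le> \<delta>\<close> one has \<open>M' * y \<le> l / 2\<close>.\<close>
  define M' where "M' = max M 1"
  define \<delta> where "\<delta> = min L (l / (2 * M'))"
  have M': "M' > 0" "M \<le> M'" by (auto simp: M'_def)
  have \<delta>: "0 < \<delta>" "\<delta> \<le> L" "\<delta> \<le> l / (2 * M')"
    using assms(1,2) M' by (auto simp: \<delta>_def)
  have "continuous_on {\<delta>..L} \<phi>"
    using cont by (rule continuous_on_subset) (use \<delta> in auto)
  then obtain y0 where y0: "y0 \<in> {\<delta>..L}" "\<And>y. y \<in> {\<delta>..L} \<Longrightarrow> \<phi> y \<le> \<phi> y0"
    using continuous_attains_sup[of "{\<delta>..L}" \<phi>] \<delta> by auto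
  have n0: "\<phi> y0 < 0"
    using neg[of y0] y0(1) \<delta> by auto
  \<comment> \<open>The second entry serves \<open>{\<delta>..L}\<close>, where
    \<open>y ^ p \<le> L ^ p\<close> gives \<open>\<mu> * y ^ p \<le> - \<phi> y0\<close>.\<close>
  define \<mu> where "\<mu> = min (l / 2) (- \<phi> y0 / L ^ p)"
  have "0 < \<mu>"
    using assms(1,2) n0 by (simp add: \<mu>_def divide_neg_pos)
  then have \<mu>: "0 < \<mu>" "\<mu> \<le> l / 2" "\<mu> \<le> - \<phi> y0 / L ^ p"
    by (simp_all only: \<mu>_def min.cobounded1 min.cobounded2)
  show ?thesis
  proof
    fix y assume y: "0 \<le> y" "y \<le> L"
    show "\<phi> y \<le> - (\<mu> * y ^ p)"
    proof (cases "y \<le> \<delta>")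
      case True
      have "M * y ^ (p + 1) \<le> M' * y * y ^ p"
        using y M' by (simp add: mult_right_mono mult.assoc)
      also have "\<dots> \<le> l / 2 * y ^ p"
      proof (rule mult_right_mono)
        have "y \<le> l / (2 * M')"
          using True \<delta> by linarith
        then show "M' * y \<le> l / 2"
          using M' by (simp add: field_simps)
      qed (use y in simp)
      finally have "\<phi> y \<le> - (l / 2 * y ^ p)"
        using app[OF y] by linarith
      also have "\<dots> \<le> - (\<mu> * y ^ p)"
        using mult_right_mono[OF \<mu>(2), of "y ^ p"] y by simp
      finally show ?thesis .
    next
      case False
      have "\<mu> * y ^ p \<le> \<mu> * L ^ p"
        using \<mu> y by (intro mult_left_mono power_mono) auto
      also have "\<dots> \<le> - \<phi> y0"
        using \<mu>(3) assms(1) by (simp add: field_simps)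
      finally show ?thesis
        using y0(2)[of y] y False by auto
    qed
  qed (use \<mu> assms(2) in auto)
qed

section \<open>The quantitative estimate on \<open>{0..L}\<close>\<close>

text \<open>A mean value estimate with a common majorant \<open>w\<close>: factor out the larger
  exponential and apply \<open>1 + z \<le> exp z\<close> to the nonpositive difference
  \<open>z\<close> of the exponents.\<close>

lemma abs_exp_diff_le:
  fixes u v w :: real
  assumes "u \<le> w" "v \<le> w"
  shows "\<bar>exp u - exp v\<bar> \<le> \<bar>u - v\<bar> * exp w"
proof -
  have *: "exp x - exp y \<le> (x - y) * exp w" if "y \<le> x" "x \<le> w" for x y :: real
  proof -
    have "exp x * (1 - exp (y - x)) \<le> exp w * (x - y)"
      using that exp_ge_add_one_self[of "y - x"] by (intro mult_mono) (linarith | simp)+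
    then show ?thesis
      by (simp add: algebra_simps flip: exp_add)
  qed
  show ?thesis
    using *[of u v] *[of v u] assms by (cases "u \<le> v") auto
qed

text \<open>The deviation from the model integrand is the error of \<open>G\<close> weighted with
  \<open>exp (t * \<phi> y)\<close>, plus \<open>A * y ^ k\<close> times the difference of the
  exponentials. The first gains a power of \<open>y\<close>, the second a factor
  \<open>t * y ^ (p + 1)\<close>; after integration both have the same order in
  \<open>t\<close>.\<close>

lemma laplace_half_interval:
  fixes \<phi> G :: "real \<Rightarrow> real"
  assumes L: "L > 0" and p: "p \<ge> 1" and l: "l > 0"
    and cont: "continuous_on {0..L} \<phi>" "continuous_on {0..L} G"
    and neg: "\<And>y. 0 < y \<Longrightarrow> y \<le> L \<Longrightarrow> \<phi> y < 0"
    and app: "\<And>y. 0 \<le> y \<Longrightarrow> y \<le> L \<Longrightarrow> \<bar>\<phi> y + l * y ^ p\<bar> \<le> M * y ^ (p + 1)"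
    and Gapp: "\<And>y. 0 \<le> y \<Longrightarrow> y \<le> L \<Longrightarrow> \<bar>G y - A * y ^ k\<bar> \<le> B * y ^ (k + 1)"
  shows "\<exists>C. \<forall>t>0.
    \<bar>integral {0..L} (\<lambda>y. exp (t * \<phi> y) * G y)
       - A * (half_line_moment p k * (t * l) powr (- (real k + 1) / real p))\<bar>
    \<le> C * t powr (- (real k + 2) / real p)"
proof -
  obtain \<mu> where \<mu>: "0 < \<mu>" "\<mu> \<le> l" "\<And>y. 0 \<le> y \<Longrightarrow> y \<le> L \<Longrightarrow> \<phi> y \<le> - (\<mu> * y ^ p)"
    using le_neg_power_of_leading_term[OF L l cont(1) neg app] by metis
  define J where "J m s = half_line_moment p m * s powr (- (real m + 1) / real p)" for m s
  have hJ: "((\<lambda>y::real. y ^ m * exp (- (s * y ^ p))) has_integral J m s) {0..}" if "s > 0" for m s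
    unfolding J_def by (rule has_integral_power_times_exp_power[OF p that])
  \<comment> \<open>At \<open>y = L\<close> the right-hand side bounds an absolute value, so its
    coefficient is nonnegative.\<close>
  have M0: "M \<ge> 0"
    using order_trans[OF abs_ge_zero app[of L]] L mult_right_le_imp_le[of 0 "L ^ (p + 1)" M] by simp
  have B0: "B \<ge> 0"
    using order_trans[OF abs_ge_zero Gapp[of L]] L mult_right_le_imp_le[of 0 "L ^ (k + 1)" B] by simp
  \<comment> \<open>The summands are the integrals of the two parts of the majorant in
    \<open>hU\<close>, with the common power of \<open>t\<close> taken out.\<close>
  define C where "C = (M * \<bar>A\<bar>) * half_line_moment p (p + 1 + k) * \<mu> powr (- (real p + real k + 2) / real p)
     + (B + \<bar>A\<bar> / L) * half_line_moment p (k + 1) * \<mu> powr (- (real k + 2) / real p)"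
  show ?thesis
  proof (intro exI allI impI)
    fix t :: real assume t: "t > 0"
    \<comment> \<open>Extension by zero puts the integral and its model on the same half-line, so
      one pointwise bound covers both the approximation and the cut-off.\<close>
    define F where "F y = (if y \<in> {0..L} then exp (t * \<phi> y) * G y else 0)" for y
    define I where "I = integral {0..L} (\<lambda>y. exp (t * \<phi> y) * G y)"
    define E where "E y = exp (- (t * \<mu> * y ^ p))" for y
    have "((\<lambda>y. exp (t * \<phi> y) * G y) has_integral I) {0..L}"
      unfolding I_def
      by (intro integrable_integral integrable_continuous_real continuous_intros cont)
    then have hF: "(F has_integral I) {0..}"
      unfolding F_def by (subst has_integral_restrict) auto
    have hD: "((\<lambda>y. F y - A * (y ^ k * exp (- (t * l * y ^ p)))) has_integral I - A * J k (t * l)) {0..}"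
      using t l by (intro has_integral_diff hF has_integral_mult_right hJ) auto
    have hU: "((\<lambda>y. t * M * \<bar>A\<bar> * (y ^ (p + 1 + k) * E y) + (B + \<bar>A\<bar> / L) * (y ^ (k + 1) * E y))
        has_integral t * M * \<bar>A\<bar> * J (p + 1 + k) (t * \<mu>) + (B + \<bar>A\<bar> / L) * J (k + 1) (t * \<mu>)) {0..}"
      unfolding E_def using t \<mu>
      by (intro has_integral_add has_integral_mult_right hJ) auto
    have bnd: "norm (F y - A * (y ^ k * exp (- (t * l * y ^ p))))
        \<le> t * M * \<bar>A\<bar> * (y ^ (p + 1 + k) * E y) + (B + \<bar>A\<bar> / L) * (y ^ (k + 1) * E y)"
      if y: "y \<in> {0..}" for y
    proof (cases "y \<le> L")
      case True
      have y0: "y \<ge> 0" using y by simp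
      have "t * \<phi> y \<le> - (t * \<mu> * y ^ p)"
        using mult_left_mono[OF \<mu>(3)[OF y0 True], of t] t by (simp add: mult.assoc)
      moreover have "- (t * l * y ^ p) \<le> - (t * \<mu> * y ^ p)"
        using t \<mu> y0 by (simp add: mult_right_mono)
      ultimately have e0: "\<bar>exp (t * \<phi> y) - exp (- (t * l * y ^ p))\<bar> \<le> \<bar>t * \<phi> y - (- (t * l * y ^ p))\<bar> * E y"
        and eE: "exp (t * \<phi> y) \<le> E y"
        unfolding E_def by (simp_all only: abs_exp_diff_le exp_le_cancel_iff)
      note e0
      also have "t * \<phi> y - (- (t * l * y ^ p)) = t * (\<phi> y + l * y ^ p)"
        by (simp add: algebra_simps)
      also have "\<bar>t * (\<phi> y + l * y ^ p)\<bar> * E y \<le> t * (M * y ^ (p + 1)) * E y"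
        using t app[OF y0 True] by (auto simp: abs_mult E_def)
      finally have e1: "\<bar>exp (t * \<phi> y) - exp (- (t * l * y ^ p))\<bar> \<le> t * (M * y ^ (p + 1)) * E y" .
      have "F y - A * (y ^ k * exp (- (t * l * y ^ p))) =
          exp (t * \<phi> y) * (G y - A * y ^ k) + A * y ^ k * (exp (t * \<phi> y) - exp (- (t * l * y ^ p)))"
        using True y0 by (simp add: F_def algebra_simps)
      also have "\<bar>\<dots>\<bar> \<le> exp (t * \<phi> y) * \<bar>G y - A * y ^ k\<bar>
          + \<bar>A\<bar> * y ^ k * \<bar>exp (t * \<phi> y) - exp (- (t * l * y ^ p))\<bar>"
        using y0 by (intro order_trans[OF abs_triangle_ineq]) (simp add: abs_mult)
      also have "\<dots> \<le> E y * (B * y ^ (k + 1)) + \<bar>A\<bar> * y ^ k * (t * (M * y ^ (p + 1)) * E y)"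
        using y0 by (intro add_mono mult_mono eE Gapp e1 mult_nonneg_nonneg) (auto simp: E_def True)
      \<comment> \<open>The new summand makes the majorant agree with the one that is used beyond
        \<open>L\<close>.\<close>
      also have "\<dots> \<le> E y * (B * y ^ (k + 1)) + \<bar>A\<bar> * y ^ k * (t * (M * y ^ (p + 1)) * E y)
           + \<bar>A\<bar> / L * (y ^ (k + 1) * E y)"
        using y0 L by (simp add: E_def)
      finally show ?thesis
        by (simp add: algebra_simps power_add)
    next
      case False
      have y0: "y > 0" using False L by simp
      have "exp (- (t * l * y ^ p)) \<le> E y"
        using t \<mu> y0 by (simp add: E_def mult_right_mono)
      \<comment> \<open>Beyond \<open>L\<close> only the model integrand is left;
        \<open>y / L \<ge> 1\<close> buys the extra power of \<open>y\<close>.\<close>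
      moreover have "y ^ k \<le> y ^ (k + 1) / L"
        using False y0 L by (simp add: field_simps mult_left_mono)
      ultimately have "\<bar>A\<bar> * (y ^ k * exp (- (t * l * y ^ p))) \<le> \<bar>A\<bar> * (y ^ (k + 1) / L * E y)"
        using y0 by (intro mult_left_mono mult_mono) (auto simp: L less_imp_le)
      also have "\<dots> \<le> t * M * \<bar>A\<bar> * (y ^ (p + 1 + k) * E y) + B * (y ^ (k + 1) * E y) + \<bar>A\<bar> * (y ^ (k + 1) / L * E y)"
        using t M0 B0 y0 by (simp add: E_def)
      finally show ?thesis
        using y0 False by (simp add: F_def abs_mult algebra_simps)
    qed
    have "norm (integral {0..} (\<lambda>y. F y - A * (y ^ k * exp (- (t * l * y ^ p)))))
        \<le> integral {0..} (\<lambda>y. t * M * \<bar>A\<bar> * (y ^ (p + 1 + k) * E y) + (B + \<bar>A\<bar> / L) * (y ^ (k + 1) * E y))"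
      by (rule integral_norm_bound_integral[OF has_integral_integrable[OF hD] has_integral_integrable[OF hU] bnd])
    then have "\<bar>I - A * J k (t * l)\<bar> \<le> t * M * \<bar>A\<bar> * J (p + 1 + k) (t * \<mu>) + (B + \<bar>A\<bar> / L) * J (k + 1) (t * \<mu>)"
      by (simp only: integral_unique[OF hD] integral_unique[OF hU] real_norm_def)
    also have "\<dots> = C * t powr (- (real k + 2) / real p)"
    proof -
      have "J (k + 1) (t * \<mu>) = half_line_moment p (k + 1) * (t powr (- (real k + 2) / real p) * \<mu> powr (- (real k + 2) / real p))"
        using t \<mu> by (simp add: J_def powr_mult add.commute add.left_commute)
      moreover have "t * J (p + 1 + k) (t * \<mu>) =
         half_line_moment p (p + 1 + k) * (t powr (- (real k + 2) / real p) * \<mu> powr (- (real p + real k + 2) / real p))"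
      proof -
        \<comment> \<open>The factor \<open>t\<close> offsets the \<open>p\<close> additional powers
          of \<open>y\<close>: \<open>1 - (p + k + 2) / p = - (k + 2) / p\<close>.\<close>
        have "t powr 1 * t powr (- (real p + real k + 2) / real p) = t powr (- (real k + 2) / real p)"
          unfolding powr_add[symmetric] using p by (intro arg_cong[of _ _ "(powr) t"]) (simp add: field_simps)
        moreover have "- (real (p + 1 + k) + 1) = - (real p + real k + 2)"
          by simp
        ultimately show ?thesis
          unfolding J_def using t \<mu> by (simp add: powr_mult)
      qed
      moreover have "t * M * \<bar>A\<bar> * J (p + 1 + k) (t * \<mu>) = M * \<bar>A\<bar> * (t * J (p + 1 + k) (t * \<mu>))"
        by (simp only: mult_ac)
      ultimately show ?thesis
        by (simp only: C_def distrib_right distrib_left mult_ac)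
    qed
    finally show "\<bar>integral {0..L} (\<lambda>y. exp (t * \<phi> y) * G y)
       - A * (half_line_moment p k * (t * l) powr (- (real k + 1) / real p))\<bar>
      \<le> C * t powr (- (real k + 2) / real p)"
      by (simp add: I_def J_def)
  qed
qed

section \<open>Taylor expansion within \<open>{a..b}\<close>\<close>

lemma times_cont_diff_mono:
  assumes "times_cont_diff a b n f" "m \<le> n"
  shows "times_cont_diff a b m f"
proof (cases "m = n")
  case False
  then have "nth_deriv a b m f differentiable_on {a..b}"
    using assms by (auto simp: times_cont_diff_def)
  then have "continuous_on {a..b} (nth_deriv a b m f)"
    by (rule differentiable_imp_continuous_on)
  then show ?thesis
    using assms by (auto simp: times_cont_diff_def)
qed (use assms in simp)

lemma times_cont_diff_continuous_on:
  assumes "times_cont_diff a b n f"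
  shows "continuous_on {a..b} f"
  using times_cont_diff_mono[OF assms, of 0] by (simp add: times_cont_diff_def nth_deriv_def)

text \<open>The last derivative is continuous on a compact interval, hence bounded.
  \<open>field_Taylor\<close> works with derivatives within a convex set, so \<open>c\<close> may be
  an endpoint.\<close>

lemma times_cont_diff_taylor:
  assumes "times_cont_diff a b (Suc n) f" "c \<in> {a..b}"
  obtains B where "\<And>x. x \<in> {a..b} \<Longrightarrow>
    \<bar>f x - (\<Sum>i\<le>n. nth_deriv a b i f c * (x - c) ^ i / fact i)\<bar> \<le> B * \<bar>x - c\<bar> ^ Suc n"
proof -
  have "compact (nth_deriv a b (Suc n) f ` {a..b})"
    using assms(1) by (intro compact_continuous_image) (auto simp: times_cont_diff_def)
  then obtain B where B: "\<And>x. x \<in> {a..b} \<Longrightarrow> norm (nth_deriv a b (Suc n) f x) \<le> B"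
    by (meson bounded_iff compact_imp_bounded imageI)
  have "\<bar>f x - (\<Sum>i\<le>n. nth_deriv a b i f c * (x - c) ^ i / fact i)\<bar> \<le> (B / fact n) * \<bar>x - c\<bar> ^ Suc n"
    if "x \<in> {a..b}" for x
    using field_Taylor[of "{a..b}" n "\<lambda>i. nth_deriv a b i f" B c x]
      times_cont_diff_has_derivative[OF assms(1)] B assms(2) that
    by (simp add: nth_deriv_def)
  then show ?thesis
    by (rule that)
qed

lemma times_cont_diff_leading_term:
  assumes "times_cont_diff a b (Suc n) f" "c \<in> {a..b}"
    and "\<And>i. i < n \<Longrightarrow> nth_deriv a b i f c = 0"
  obtains B where "\<And>x. x \<in> {a..b} \<Longrightarrow>
    \<bar>f x - nth_deriv a b n f c / fact n * (x - c) ^ n\<bar> \<le> B * \<bar>x - c\<bar> ^ Suc n"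
proof -
  have "(\<Sum>i\<le>n. nth_deriv a b i f c * (x - c) ^ i / fact i) = nth_deriv a b n f c / fact n * (x - c) ^ n" for x
    using assms(3) by (simp flip: lessThan_Suc_atMost)
  then show ?thesis
    using times_cont_diff_taylor[OF assms(1,2)] that by metis
qed

text \<open>Supplies the case \<open>p = 1\<close>: a nonzero slope at an endpoint, and Fermat's
  criterion inside.\<close>

lemma times_cont_diff_linear_approx:
  assumes "times_cont_diff a b 2 f" "c \<in> {a..b}"
  obtains M where "\<And>x. x \<in> {a..b} \<Longrightarrow> \<bar>f x - f c - nth_deriv a b 1 f c * (x - c)\<bar> \<le> M * \<bar>x - c\<bar> ^ 2"
proof -
  have "times_cont_diff a b (Suc 1) f"
    using assms(1) by (simp add: numeral_2_eq_2)
  moreover have "(\<Sum>i\<le>1. nth_deriv a b i f c * (x - c) ^ i / fact i) = f c + nth_deriv a b 1 f c * (x - c)" for x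
    by simp (simp add: nth_deriv_def)
  ultimately show ?thesis
    using times_cont_diff_taylor[of a b 1 f c] assms(2) that unfolding diff_diff_eq Suc_1 by metis
qed

text \<open>Supplies the case \<open>p = 2\<close>; the third derivative controls the cubic
  error.\<close>

lemma times_cont_diff_quadratic_approx:
  assumes "times_cont_diff a b 3 f" "c \<in> {a..b}" "nth_deriv a b 1 f c = 0"
  obtains M where "\<And>x. x \<in> {a..b} \<Longrightarrow> \<bar>f x - f c - nth_deriv a b 2 f c / 2 * (x - c) ^ 2\<bar> \<le> M * \<bar>x - c\<bar> ^ 3"
proof -
  have "times_cont_diff a b (Suc 2) f"
    using assms(1) by (simp add: eval_nat_numeral)
  moreover have "(\<Sum>i\<le>2. nth_deriv a b i f c * (x - c) ^ i / fact i)
      = f c + nth_deriv a b 2 f c / 2 * (x - c) ^ 2" for x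
    using assms(3) by (simp add: numeral_2_eq_2) (simp add: nth_deriv_def)
  moreover have "Suc 2 = 3"
    by simp
  ultimately show ?thesis
    using times_cont_diff_taylor[of a b 2 f c] assms(2) that unfolding diff_diff_eq by metis
qed

section \<open>From \<open>{a..b}\<close> to one side of \<open>c\<close>\<close>

text \<open>\<open>\<sigma>\<close> is the direction in which one leaves \<open>c\<close>. For
  \<open>x = c + \<sigma> * y\<close> the power \<open>(x - c) ^ p\<close> is
  \<open>\<sigma> ^ p * y ^ p\<close>, so the half-interval estimate applies with
  \<open>l = - \<alpha> * \<sigma> ^ p\<close> and amplitude \<open>A * \<sigma> ^ k\<close>. The
  maximum gives \<open>l \<ge> 0\<close>, and \<open>\<alpha> \<noteq> 0\<close> excludes
  equality.\<close>

lemma laplace_side: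
  fixes g h :: "real \<Rightarrow> real"
  assumes \<sigma>: "\<sigma> = 1 \<or> \<sigma> = - 1" and L: "L > 0" and p: "p \<ge> 1"
    and ivl: "\<And>y. y \<in> {0..L} \<Longrightarrow> c + \<sigma> * y \<in> {a..b}"
    and cont: "continuous_on {a..b} h" "continuous_on {a..b} g"
    and max: "\<forall>x\<in>{a..b} - {c}. h x < h c"
    and h: "\<And>x. x \<in> {a..b} \<Longrightarrow> \<bar>h x - h c - \<alpha> * (x - c) ^ p\<bar> \<le> M * \<bar>x - c\<bar> ^ (p + 1)"
    and g: "\<And>x. x \<in> {a..b} \<Longrightarrow> \<bar>g x - A * (x - c) ^ k\<bar> \<le> B * \<bar>x - c\<bar> ^ (k + 1)"
    and \<alpha>: "\<alpha> \<noteq> 0"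
  shows "- \<alpha> * \<sigma> ^ p > 0"
    "\<exists>C. \<forall>t>0.
      \<bar>integral {0..L} (\<lambda>y. exp (t * h (c + \<sigma> * y)) * g (c + \<sigma> * y))
        - exp (t * h c) * (A * \<sigma> ^ k * half_line_moment p k * (t * (- \<alpha> * \<sigma> ^ p)) powr (- (real k + 1) / real p))\<bar>
      \<le> exp (t * h c) * (C * t powr (- (real k + 2) / real p))"
proof -
  define \<phi> where "\<phi> y = h (c + \<sigma> * y) - h c" for y
  define G where "G y = g (c + \<sigma> * y)" for y
  have sg: "\<sigma> \<noteq> 0" "\<bar>\<sigma>\<bar> = 1"
    using \<sigma> by auto
  have contc: "continuous_on {0..L} (\<lambda>y. F (c + \<sigma> * y))" if "continuous_on {a..b} F" for F :: "real \<Rightarrow> real"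
    by (rule continuous_on_compose2[OF that]) (use ivl in \<open>auto intro!: continuous_intros\<close>)
  have neg: "\<phi> y < 0" if "0 < y" "y \<le> L" for y
    using max ivl[of y] that sg by (auto simp: \<phi>_def)
  have app: "\<bar>\<phi> y + (- \<alpha> * \<sigma> ^ p) * y ^ p\<bar> \<le> M * y ^ (p + 1)" if "0 \<le> y" "y \<le> L" for y
    using h[OF ivl[of y]] that sg by (simp add: \<phi>_def power_mult_distrib abs_mult mult.assoc)
  have Gapp: "\<bar>G y - (A * \<sigma> ^ k) * y ^ k\<bar> \<le> B * y ^ (k + 1)" if "0 \<le> y" "y \<le> L" for y
    using g[OF ivl[of y]] that sg by (simp add: G_def power_mult_distrib abs_mult mult.assoc)
  have "- \<alpha> * \<sigma> ^ p \<ge> 0"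
    by (rule leading_coeff_nonneg[OF L, of \<phi>]) (use neg app in \<open>auto intro: less_imp_le\<close>)
  moreover have "- \<alpha> * \<sigma> ^ p \<noteq> 0"
    using \<alpha> sg by simp
  ultimately have l: "- \<alpha> * \<sigma> ^ p > 0"
    by linarith
  have cont': "continuous_on {0..L} \<phi>" "continuous_on {0..L} G"
    unfolding \<phi>_def G_def by (intro continuous_intros contc cont)+
  obtain C where C: "\<forall>t>0.
    \<bar>integral {0..L} (\<lambda>y. exp (t * \<phi> y) * G y)
       - (A * \<sigma> ^ k) * (half_line_moment p k * (t * (- \<alpha> * \<sigma> ^ p)) powr (- (real k + 1) / real p))\<bar>
    \<le> C * t powr (- (real k + 2) / real p)"
    using laplace_half_interval[OF L p l cont' neg app Gapp] ..
  show "- \<alpha> * \<sigma> ^ p > 0"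
    by (fact l)
  show "\<exists>C. \<forall>t>0.
      \<bar>integral {0..L} (\<lambda>y. exp (t * h (c + \<sigma> * y)) * g (c + \<sigma> * y))
        - exp (t * h c) * (A * \<sigma> ^ k * half_line_moment p k * (t * (- \<alpha> * \<sigma> ^ p)) powr (- (real k + 1) / real p))\<bar>
      \<le> exp (t * h c) * (C * t powr (- (real k + 2) / real p))"
  proof (intro exI allI impI)
    fix t :: real assume t: "t > 0"
    have "integral {0..L} (\<lambda>y. exp (t * h (c + \<sigma> * y)) * g (c + \<sigma> * y))
        = integral {0..L} (\<lambda>y. exp (t * h c) * (exp (t * \<phi> y) * G y))"
      by (simp add: \<phi>_def G_def right_diff_distrib exp_diff del: integral_mult_right)
    also have "\<dots> = exp (t * h c) * integral {0..L} (\<lambda>y. exp (t * \<phi> y) * G y)"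
      by simp
    finally have "integral {0..L} (\<lambda>y. exp (t * h (c + \<sigma> * y)) * g (c + \<sigma> * y))
        - exp (t * h c) * (A * \<sigma> ^ k * half_line_moment p k * (t * (- \<alpha> * \<sigma> ^ p)) powr (- (real k + 1) / real p))
      = exp (t * h c) * (integral {0..L} (\<lambda>y. exp (t * \<phi> y) * G y)
       - (A * \<sigma> ^ k) * (half_line_moment p k * (t * (- \<alpha> * \<sigma> ^ p)) powr (- (real k + 1) / real p)))"
      by (simp only: right_diff_distrib mult.assoc)
    then show "\<bar>integral {0..L} (\<lambda>y. exp (t * h (c + \<sigma> * y)) * g (c + \<sigma> * y))
        - exp (t * h c) * (A * \<sigma> ^ k * half_line_moment p k * (t * (- \<alpha> * \<sigma> ^ p)) powr (- (real k + 1) / real p))\<bar>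
      \<le> exp (t * h c) * (C * t powr (- (real k + 2) / real p))"
      using C[rule_format, OF t] by (simp only: abs_mult abs_exp_cancel mult_le_cancel_left_pos exp_gt_zero)
  qed
qed

text \<open>The factor \<open>1\<close> gives both sides of \<open>c\<close> the common form
  \<open>c + \<sigma> * y\<close>.\<close>

lemma integral_right_of:
  fixes f :: "real \<Rightarrow> real"
  shows "integral {c..b} f = integral {0..b - c} (\<lambda>y. f (c + 1 * y))"
  using integral_shift_real_ivl[of c c b f] by (simp add: add.commute)

lemma integral_left_of:
  fixes f :: "real \<Rightarrow> real"
  shows "integral {a..c} f = integral {0..c - a} (\<lambda>y. f (c + (- 1) * y))"
  using integral_shift_real_ivl[of a c c f] Henstock_Kurzweil_Integration.integral_reflect_real[of 0 "a - c" "\<lambda>x. f (x + c)"]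
  by (simp add: add.commute)

text \<open>The identity forces \<open>R t = I t / E t - m t\<close>; dividing the error bound by
  \<open>E t > 0\<close> makes it a big-O bound.\<close>

lemma bigo_remainder:
  fixes I E m :: "real \<Rightarrow> real"
  assumes "\<And>t. t > 0 \<Longrightarrow> \<bar>I t - E t * m t\<bar> \<le> E t * (C * t powr e)" "\<And>t. E t > 0"
  shows "\<exists>R. R \<in> O[at_top](\<lambda>t. t powr e) \<and> (\<forall>t>0. I t = E t * (m t + R t))"
proof (intro exI conjI allI impI)
  define R where "R t = I t / E t - m t" for t
  have "\<bar>R t\<bar> \<le> C * t powr e" if "t > 0" for t
  proof -
    have "I t - E t * m t = E t * R t"
      using assms(2)[of t] by (simp add: R_def field_simps)
    then have "E t * \<bar>R t\<bar> \<le> E t * (C * t powr e)"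
      using assms(1)[OF that] assms(2)[of t] by (simp add: abs_mult)
    then show ?thesis
      using assms(2)[of t] by simp
  qed
  then show "R \<in> O[at_top](\<lambda>t. t powr e)"
    by (intro bigoI[of _ C] eventually_mono[OF eventually_gt_at_top[of 0]]) auto
  show "I t = E t * (m t + R t)" for t
    using assms(2)[of t] by (simp add: R_def)
qed

section \<open>Double factorials and closed forms of the coefficients\<close>

text \<open>The even factors of (2j)! multiply to \<open>2 ^ j * fact j\<close>, the odd ones to the
  double factorial. The induction starts from the convention (-1)!! = 1.\<close>

lemma double_fact_odd: "double_fact (2 * int j - 1) * (2 ^ j * fact j) = fact (2 * j)"
proof (induction j)
  case 0
  then show ?case by (simp add: double_fact_minus_one)
next
  case (Suc j)
  have "double_fact (2 * int (Suc j) - 1) = (2 * int j + 1) * double_fact (2 * int j - 1)"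
    using double_fact_rec[of "2 * int (Suc j) - 1"] by (simp add: algebra_simps)
  then have "double_fact (2 * int (Suc j) - 1) * (2 ^ Suc j * fact (Suc j))
      = (2 * int j + 1) * (2 * int j + 2) * (double_fact (2 * int j - 1) * (2 ^ j * fact j))"
    by (simp add: algebra_simps)
  also have "\<dots> = fact (2 * Suc j)"
    unfolding Suc.IH by (simp add: algebra_simps)
  finally show ?case .
qed

lemma half_line_moment_2_even':
  assumes "even k"
  shows "half_line_moment 2 k = sqrt (pi / 2 ^ k) * of_int (double_fact (int k - 1)) / 2"
proof -
  obtain j where k: "k = 2 * j"
    using assms by blast
  have "(fact (2 * j) :: real) = of_int (double_fact (int k - 1)) * (2 ^ j * fact j)"
    using arg_cong[OF double_fact_odd[of j], of real_of_int] k by simp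
  moreover have "sqrt (pi / 2 ^ k) = sqrt pi / 2 ^ j"
    by (simp add: k real_sqrt_divide power_even_eq)
  moreover have "(2 :: real) ^ (2 * j) = 2 ^ j * 2 ^ j"
    by (simp add: mult_2 power_add)
  ultimately show ?thesis
    using half_line_moment_2_even[of j] k by simp
qed

text \<open>\<open>\<sigma> ^ k\<close> produces the sign that separates the endpoints for odd
  \<open>k\<close>. The half on the right cancels the factor 2 in
  \<open>powr_half_scale\<close>.\<close>

lemma gamma_coeff_eq:
  "half_line_moment 2 k * \<sigma> ^ k / fact k = gamma_coeff a k c / 2"
  if "\<sigma> = (if c = a then 1 else - 1)" for \<sigma> :: real
proof (cases "even k")
  case True
  then show ?thesis
    using that by (simp add: gamma_coeff_def half_line_moment_2_even')
next
  case False
  then obtain j where "k = 2 * j + 1"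
    using oddE by blast
  then show ?thesis
    using that half_line_moment_2_odd[of j] by (simp add: gamma_coeff_def)
qed

text \<open>\<open>H\<close> stands for |h''(c)|, so \<open>H / 2\<close> is the size of the
  quadratic coefficient. Moving the 2 under the root gives \<open>(2 / H) ^ (k + 1)\<close>. The
  integer power covers \<open>k = 0\<close>, where its exponent is -1.\<close>

lemma powr_half_scale:
  fixes H t :: real
  assumes "H > 0" "t > 0"
  shows "(t * (H / 2)) powr (- (real k + 1) / 2) =
    2 * sqrt (2 powi (int k - 1) / H ^ (k + 1)) * t powr (- 1 / 2 - real k / 2)"
proof -
  have e: "- (real k + 1) / 2 = - 1 / 2 - real k / 2"
    by (simp add: field_simps)
  have "2 * sqrt (2 powi (int k - 1) / H ^ (k + 1)) = sqrt (2\<^sup>2 * (2 powi (int k - 1) / H ^ (k + 1)))"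
    by (subst real_sqrt_mult) simp
  also have "2\<^sup>2 * (2 powi (int k - 1) / H ^ (k + 1)) = (2 / H) ^ (k + 1)"
    by (simp add: power_int_diff power_divide)
  also have "sqrt ((2 / H) ^ (k + 1)) = ((2 / H) powr real (k + 1)) powr (1 / 2)"
    using assms(1) by (subst powr_realpow) (auto simp: powr_half_sqrt)
  also have "\<dots> = (2 / H) powr ((real k + 1) / 2)"
    by (simp add: powr_powr add.commute)
  also have "\<dots> = (H / 2) powr (- (real k + 1) / 2)"
    using assms(1) by (simp only: minus_divide_left[symmetric] powr_minus) (simp add: powr_divide)
  finally have *: "(H / 2) powr (- (real k + 1) / 2) = 2 * sqrt (2 powi (int k - 1) / H ^ (k + 1))" ..
  have "(t * (H / 2)) powr (- (real k + 1) / 2) = t powr (- (real k + 1) / 2) * (H / 2) powr (- (real k + 1) / 2)"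
    by (rule powr_mult)
  then show ?thesis
    unfolding * by (simp only: e mult.commute)
qed

section \<open>Expansion at interior and endpoint maxima\<close>

text \<open>For even \<open>p\<close> and \<open>k\<close> the signs \<open>\<sigma> ^ p\<close> and
  \<open>\<sigma> ^ k\<close> are 1 on both sides of \<open>c\<close>, so the two halves contribute
  the same main term, whence the factor 2.\<close>

lemma laplace_interior:
  fixes g h :: "real \<Rightarrow> real"
  assumes ab: "a < c" "c < b"
    and p: "p \<ge> 1"
    and cont: "continuous_on {a..b} h" "continuous_on {a..b} g"
    and max: "\<forall>x\<in>{a..b} - {c}. h x < h c"
    and h: "\<And>x. x \<in> {a..b} \<Longrightarrow> \<bar>h x - h c - \<alpha> * (x - c) ^ p\<bar> \<le> M * \<bar>x - c\<bar> ^ (p + 1)"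
    and g: "\<And>x. x \<in> {a..b} \<Longrightarrow> \<bar>g x - A * (x - c) ^ k\<bar> \<le> B * \<bar>x - c\<bar> ^ (k + 1)"
    and \<alpha>: "\<alpha> \<noteq> 0" and even: "even p" "even k"
  shows "\<alpha> < 0" "\<exists>R. R \<in> O[at_top](\<lambda>t. t powr (- (real k + 2) / real p)) \<and>
      (\<forall>t>0. laplace_integral a b g h t = exp (t * h c) *
        (2 * A * half_line_moment p k * (t * - \<alpha>) powr (- (real k + 1) / real p) + R t))"
proof -
  have one: "(1::real) = 1 \<or> (1::real) = - 1" "b - c > 0" "\<And>y. y \<in> {0..b - c} \<Longrightarrow> c + 1 * y \<in> {a..b}"
    and minus_one: "(- 1::real) = 1 \<or> (- 1::real) = - 1" "c - a > 0" "\<And>y. y \<in> {0..c - a} \<Longrightarrow> c + (- 1) * y \<in> {a..b}"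
    using ab by auto
  obtain C1 where
    C1: "\<forall>t>0.
      \<bar>integral {0..b - c} (\<lambda>y. exp (t * h (c + 1 * y)) * g (c + 1 * y))
        - exp (t * h c) * (A * 1 ^ k * half_line_moment p k * (t * (- \<alpha> * 1 ^ p)) powr (- (real k + 1) / real p))\<bar>
      \<le> exp (t * h c) * (C1 * t powr (- (real k + 2) / real p))"
    using laplace_side(2)[OF one(1,2) p one(3) cont max h g \<alpha>] ..
  obtain C2 where
    C2: "\<forall>t>0.
      \<bar>integral {0..c - a} (\<lambda>y. exp (t * h (c + (- 1) * y)) * g (c + (- 1) * y))
        - exp (t * h c) * (A * (- 1) ^ k * half_line_moment p k * (t * (- \<alpha> * (- 1) ^ p)) powr (- (real k + 1) / real p))\<bar>
      \<le> exp (t * h c) * (C2 * t powr (- (real k + 2) / real p))"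
    using laplace_side(2)[OF minus_one(1,2) p minus_one(3) cont max h g \<alpha>] ..
  show "\<alpha> < 0"
    using laplace_side(1)[OF one(1,2) p one(3) cont max h g \<alpha>] by simp
  show "\<exists>R. R \<in> O[at_top](\<lambda>t. t powr (- (real k + 2) / real p)) \<and>
      (\<forall>t>0. laplace_integral a b g h t = exp (t * h c) *
        (2 * A * half_line_moment p k * (t * - \<alpha>) powr (- (real k + 1) / real p) + R t))"
  proof (rule bigo_remainder)
    fix t :: real assume t: "t > 0"
    define f where "f x = exp (t * h x) * g x" for x
    have "f integrable_on {a..b}"
      unfolding f_def by (intro integrable_continuous_real continuous_intros cont)
    then have "laplace_integral a b g h t = integral {c..b} f + integral {a..c} f"
      unfolding laplace_integral_def f_def[symmetric]
      using Henstock_Kurzweil_Integration.integral_combine[of a c b f] ab by simp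
    also have "\<dots> = integral {0..b - c} (\<lambda>y. f (c + 1 * y)) + integral {0..c - a} (\<lambda>y. f (c + (- 1) * y))"
      by (simp only: integral_right_of[of c b] integral_left_of[of a c])
    finally have *: "laplace_integral a b g h t = \<dots>" .
    define T where "T = exp (t * h c) * (A * half_line_moment p k * (t * - \<alpha>) powr (- (real k + 1) / real p))"
    have "\<bar>integral {0..b - c} (\<lambda>y. f (c + 1 * y)) - T\<bar> \<le> exp (t * h c) * (C1 * t powr (- (real k + 2) / real p))"
      using C1[rule_format, OF t] by (simp only: f_def T_def power_one mult_1_right)
    moreover have "\<bar>integral {0..c - a} (\<lambda>y. f (c + (- 1) * y)) - T\<bar> \<le> exp (t * h c) * (C2 * t powr (- (real k + 2) / real p))"
      using C2[rule_format, OF t] even by (simp only: f_def T_def power_minus_even power_one mult_1_right)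
    moreover have "exp (t * h c) * (2 * A * half_line_moment p k * (t * - \<alpha>) powr (- (real k + 1) / real p)) = T + T"
      by (simp add: T_def)
    ultimately show "\<bar>laplace_integral a b g h t - exp (t * h c) *
        (2 * A * half_line_moment p k * (t * - \<alpha>) powr (- (real k + 1) / real p))\<bar>
      \<le> exp (t * h c) * ((C1 + C2) * t powr (- (real k + 2) / real p))"
      unfolding * by (simp only: distrib_left distrib_right)
  qed simp
qed

text \<open>At an endpoint a single side with \<open>L = b - a\<close> exhausts the interval;
  \<open>\<sigma>\<close> points inward.\<close>

lemma laplace_endpoint:
  fixes g h :: "real \<Rightarrow> real"
  assumes ab: "a < b" and c: "c = a \<or> c = b" and \<sigma>: "\<sigma> = (if c = a then 1 else - 1)"
    and p: "p \<ge> 1"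
    and cont: "continuous_on {a..b} h" "continuous_on {a..b} g"
    and max: "\<forall>x\<in>{a..b} - {c}. h x < h c"
    and h: "\<And>x. x \<in> {a..b} \<Longrightarrow> \<bar>h x - h c - \<alpha> * (x - c) ^ p\<bar> \<le> M * \<bar>x - c\<bar> ^ (p + 1)"
    and g: "\<And>x. x \<in> {a..b} \<Longrightarrow> \<bar>g x - A * (x - c) ^ k\<bar> \<le> B * \<bar>x - c\<bar> ^ (k + 1)"
    and \<alpha>: "\<alpha> \<noteq> 0"
  shows "- \<alpha> * \<sigma> ^ p > 0" "\<exists>R. R \<in> O[at_top](\<lambda>t. t powr (- (real k + 2) / real p)) \<and>
      (\<forall>t>0. laplace_integral a b g h t = exp (t * h c) *
        (A * \<sigma> ^ k * half_line_moment p k * (t * (- \<alpha> * \<sigma> ^ p)) powr (- (real k + 1) / real p) + R t))"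
proof -
  have \<sigma>': "\<sigma> = 1 \<or> \<sigma> = - 1" "b - a > 0" "\<And>y. y \<in> {0..b - a} \<Longrightarrow> c + \<sigma> * y \<in> {a..b}"
    using ab c by (auto simp: \<sigma>)
  obtain C where
    C: "\<forall>t>0.
      \<bar>integral {0..b - a} (\<lambda>y. exp (t * h (c + \<sigma> * y)) * g (c + \<sigma> * y))
        - exp (t * h c) * (A * \<sigma> ^ k * half_line_moment p k * (t * (- \<alpha> * \<sigma> ^ p)) powr (- (real k + 1) / real p))\<bar>
      \<le> exp (t * h c) * (C * t powr (- (real k + 2) / real p))"
    using laplace_side(2)[OF \<sigma>'(1,2) p \<sigma>'(3) cont max h g \<alpha>] ..
  show "- \<alpha> * \<sigma> ^ p > 0"
    by (rule laplace_side(1)[OF \<sigma>'(1,2) p \<sigma>'(3) cont max h g \<alpha>])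
  have "laplace_integral a b g h t = integral {0..b - a} (\<lambda>y. exp (t * h (c + \<sigma> * y)) * g (c + \<sigma> * y))" for t
    using c integral_right_of[of a b "\<lambda>x. exp (t * h x) * g x"] integral_left_of[of a b "\<lambda>x. exp (t * h x) * g x"]
    by (auto simp: laplace_integral_def \<sigma>)
  then show "\<exists>R. R \<in> O[at_top](\<lambda>t. t powr (- (real k + 2) / real p)) \<and>
      (\<forall>t>0. laplace_integral a b g h t = exp (t * h c) *
        (A * \<sigma> ^ k * half_line_moment p k * (t * (- \<alpha> * \<sigma> ^ p)) powr (- (real k + 1) / real p) + R t))"
    using C by (intro bigo_remainder[where C = C]) (simp_all only: exp_gt_zero)
qed

text \<open>Fermat's criterion: \<open>leading_coeff_nonneg\<close> with \<open>p = 1\<close>,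
  applied to the right and to the left of \<open>c\<close>, bounds the slope from both sides by
  0.\<close>

lemma deriv_eq_zero_at_interior_max:
  assumes "times_cont_diff a b 2 h" "a < c" "c < b"
    and max: "\<forall>x\<in>{a..b} - {c}. h x < h c"
  shows "nth_deriv a b 1 h c = 0"
proof -
  have "c \<in> {a..b}"
    using assms(2,3) by simp
  then obtain M where M: "\<And>x. x \<in> {a..b} \<Longrightarrow> \<bar>h x - h c - nth_deriv a b 1 h c * (x - c)\<bar> \<le> M * \<bar>x - c\<bar> ^ 2"
    using times_cont_diff_linear_approx[OF assms(1)] by metis
  have "- nth_deriv a b 1 h c \<ge> 0"
  proof (rule leading_coeff_nonneg[of "b - c" "\<lambda>y. h (c + y) - h c" _ 1 M])
    fix y assume y: "0 < y" "y \<le> b - c"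
    then have "c + y \<in> {a..b} - {c}"
      using assms(2) by auto
    with y show "h (c + y) - h c \<le> 0" "\<bar>h (c + y) - h c + - nth_deriv a b 1 h c * y ^ 1\<bar> \<le> M * y ^ (1 + 1)"
      using bspec[OF max, of "c + y"] M[of "c + y"] by (simp_all add: power2_eq_square)
  qed (use assms in simp)
  moreover have "nth_deriv a b 1 h c \<ge> 0"
  proof (rule leading_coeff_nonneg[of "c - a" "\<lambda>y. h (c - y) - h c" _ 1 M])
    fix y assume y: "0 < y" "y \<le> c - a"
    then have "c - y \<in> {a..b} - {c}"
      using assms(3) by auto
    with y show "h (c - y) - h c \<le> 0" "\<bar>h (c - y) - h c + nth_deriv a b 1 h c * y ^ 1\<bar> \<le> M * y ^ (1 + 1)"
      using bspec[OF max, of "c - y"] M[of "c - y"] by (simp_all add: power2_eq_square)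
  qed (use assms in simp)
  ultimately show ?thesis
    by linarith
qed

section \<open>The three cases\<close>

theorem theorem1:
  fixes a b c :: real and g h :: "real \<Rightarrow> real" and k :: nat
  assumes "a < b"
    and "c \<in> {a..b}"
    and "\<forall>x\<in>{a..b} - {c}. h x < h c"
    and "times_cont_diff a b 3 h"
    and "nth_deriv a b 2 h c \<noteq> 0"
    and "times_cont_diff a b (k + 1) g"
    and "\<forall>j<k. nth_deriv a b j g c = 0"
    and "nth_deriv a b k g c \<noteq> 0"
  shows
    "(a < c \<and> c < b \<and> even k \<longrightarrow>
       (\<exists>R. R \<in> O[at_top](\<lambda>t. t powr (- 1 - real k / 2)) \<and>
         (\<forall>t>0. laplace_integral a b g h t =
           exp (t * h c) *
             (t powr (- 1 / 2 - real k / 2) * nth_deriv a b k g c *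
                sqrt (2 * pi / \<bar>nth_deriv a b 2 h c\<bar> ^ (k + 1)) *
                (of_int (double_fact (int k - 1)) / fact k)
              + R t)))) \<and>
     ((c = a \<or> c = b) \<and> nth_deriv a b 1 h c = 0 \<longrightarrow>
       (\<exists>R. R \<in> O[at_top](\<lambda>t. t powr (- 1 - real k / 2)) \<and>
         (\<forall>t>0. laplace_integral a b g h t =
           exp (t * h c) *
             (t powr (- 1 / 2 - real k / 2) * nth_deriv a b k g c *
                sqrt (2 powi (int k - 1) / \<bar>nth_deriv a b 2 h c\<bar> ^ (k + 1)) *
                gamma_coeff a k c
              + R t)))) \<and>
     ((c = a \<or> c = b) \<and> nth_deriv a b 1 h c \<noteq> 0 \<longrightarrow>
       (\<exists>R. R \<in> O[at_top](\<lambda>t. t powr (- 2 - real k)) \<and>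
         (\<forall>t>0. laplace_integral a b g h t =
           exp (t * h c) *
             (t powr (- 1 - real k) * nth_deriv a b k g c *
                nth_deriv a b 1 h c powi (- 1 - int k) * (- 1) ^ k * eta_coeff a c
              + R t))))"
proof -
  define A where "A = nth_deriv a b k g c / fact k"
  define h1 where "h1 = nth_deriv a b 1 h c"
  define h2 where "h2 = nth_deriv a b 2 h c"
  define \<sigma> :: real where "\<sigma> = (if c = a then 1 else - 1)"
  have cont: "continuous_on {a..b} h" "continuous_on {a..b} g"
    using assms(4,6) by (auto intro: times_cont_diff_continuous_on)
  have h_2: "times_cont_diff a b 2 h"
    using times_cont_diff_mono[OF assms(4)] by simp
  obtain B where B: "\<And>x. x \<in> {a..b} \<Longrightarrow> \<bar>g x - A * (x - c) ^ k\<bar> \<le> B * \<bar>x - c\<bar> ^ (k + 1)"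
    using times_cont_diff_leading_term[of a b k g c] assms(2,6,7) unfolding A_def by auto
  \<comment> \<open>The general error exponent at \<open>p = 2\<close>; \<open>real 2\<close> is the
    instance of \<open>real p\<close>.\<close>
  have e2: "- (real k + 2) / real 2 = - 1 - real k / 2"
    by (simp add: field_simps)
  have quadratic: "\<exists>M. \<forall>x\<in>{a..b}. \<bar>h x - h c - h2 / 2 * (x - c) ^ 2\<bar> \<le> M * \<bar>x - c\<bar> ^ (2 + 1)" if "h1 = 0"
    using times_cont_diff_quadratic_approx[OF assms(4,2)] that unfolding h1_def h2_def
    by (simp only: numeral_plus_one Num.add_num_simps) metis
  have "\<exists>R. R \<in> O[at_top](\<lambda>t. t powr (- 1 - real k / 2)) \<and>
         (\<forall>t>0. laplace_integral a b g h t =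
           exp (t * h c) *
             (t powr (- 1 / 2 - real k / 2) * nth_deriv a b k g c *
                sqrt (2 * pi / \<bar>h2\<bar> ^ (k + 1)) *
                (of_int (double_fact (int k - 1)) / fact k)
              + R t))" if c: "a < c" "c < b" and k: "even k"
  proof -
    have "h1 = 0"
      using deriv_eq_zero_at_interior_max[OF h_2 c assms(3)] by (simp add: h1_def)
    then obtain M where M: "\<And>x. x \<in> {a..b} \<Longrightarrow> \<bar>h x - h c - h2 / 2 * (x - c) ^ 2\<bar> \<le> M * \<bar>x - c\<bar> ^ (2 + 1)"
      using quadratic by blast
    have p: "(1::nat) \<le> 2" "even (2::nat)" "h2 / 2 \<noteq> 0"
      using assms(5) by (auto simp: h2_def)
    note I = laplace_interior[OF c p(1) cont assms(3) M B p(3,2) k]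
    have h2: "h2 < 0"
      using I(1) by simp
    have m: "2 * A * half_line_moment 2 k * (t * - (h2 / 2)) powr (- (real k + 1) / real 2)
       = t powr (- 1 / 2 - real k / 2) * nth_deriv a b k g c * sqrt (2 * pi / \<bar>h2\<bar> ^ (k + 1)) *
                (of_int (double_fact (int k - 1)) / fact k)" if "t > 0" for t
    proof -
      have "(t * - (h2 / 2)) powr (- (real k + 1) / real 2)
          = 2 * sqrt (2 powi (int k - 1) / \<bar>h2\<bar> ^ (k + 1)) * t powr (- 1 / 2 - real k / 2)"
        using powr_half_scale[of "\<bar>h2\<bar>" t k] h2 that by simp
      \<comment> \<open>The roots combine because
        \<open>4 * (1 / 2 ^ k) * 2 powi (int k - 1) = 2\<close>.\<close>
      moreover have "2 * (sqrt (pi / 2 ^ k) * sqrt (2 powi (int k - 1) / \<bar>h2\<bar> ^ (k + 1)))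
          = sqrt (2 * pi / \<bar>h2\<bar> ^ (k + 1))"
      proof -
        have "2 * (sqrt (pi / 2 ^ k) * sqrt (2 powi (int k - 1) / \<bar>h2\<bar> ^ (k + 1)))
          = sqrt (2\<^sup>2 * (pi / 2 ^ k * (2 powi (int k - 1) / \<bar>h2\<bar> ^ (k + 1))))"
          by (subst real_sqrt_mult, subst real_sqrt_mult) simp
        also have "2\<^sup>2 * (pi / 2 ^ k * (2 powi (int k - 1) / \<bar>h2\<bar> ^ (k + 1))) = 2 * pi / \<bar>h2\<bar> ^ (k + 1)"
          by (simp add: power_int_diff)
        finally show ?thesis .
      qed
      ultimately show ?thesis
        using k by (simp only: half_line_moment_2_even' A_def flip: \<open>2 * _ = _\<close>) simp
    qed
    \<comment> \<open>\<open>m\<close> holds only for \<open>t > 0\<close>; the congruence rule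
      makes this premise available to the rewriting.\<close>
    show ?thesis
      using I(2) unfolding e2 by (simp only: m cong: imp_cong)
  qed
  moreover have "\<exists>R. R \<in> O[at_top](\<lambda>t. t powr (- 1 - real k / 2)) \<and>
         (\<forall>t>0. laplace_integral a b g h t =
           exp (t * h c) *
             (t powr (- 1 / 2 - real k / 2) * nth_deriv a b k g c *
                sqrt (2 powi (int k - 1) / \<bar>h2\<bar> ^ (k + 1)) *
                gamma_coeff a k c
              + R t))" if c: "c = a \<or> c = b" and "h1 = 0"
  proof -
    obtain M where M: "\<And>x. x \<in> {a..b} \<Longrightarrow> \<bar>h x - h c - h2 / 2 * (x - c) ^ 2\<bar> \<le> M * \<bar>x - c\<bar> ^ (2 + 1)"
      using quadratic \<open>h1 = 0\<close> by blast
    have p: "(1::nat) \<le> 2" "h2 / 2 \<noteq> 0"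
      using assms(5) by (auto simp: h2_def)
    note I = laplace_endpoint[OF assms(1) c \<sigma>_def p(1) cont assms(3) M B p(2)]
    \<comment> \<open>Hence both endpoints share the same decay rate, and differ only through
      \<open>\<sigma> ^ k\<close>.\<close>
    have \<sigma>: "\<sigma>\<^sup>2 = 1"
      by (simp add: \<sigma>_def)
    have h2: "h2 < 0"
      using I(1) \<sigma> by simp
    have m: "A * \<sigma> ^ k * half_line_moment 2 k * (t * (- (h2 / 2) * \<sigma>\<^sup>2)) powr (- (real k + 1) / real 2)
       = t powr (- 1 / 2 - real k / 2) * nth_deriv a b k g c *
                sqrt (2 powi (int k - 1) / \<bar>h2\<bar> ^ (k + 1)) * gamma_coeff a k c" if "t > 0" for t
    proof -
      have "(t * (- (h2 / 2) * \<sigma>\<^sup>2)) powr (- (real k + 1) / real 2)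
          = 2 * sqrt (2 powi (int k - 1) / \<bar>h2\<bar> ^ (k + 1)) * t powr (- 1 / 2 - real k / 2)"
        using powr_half_scale[of "\<bar>h2\<bar>" t k] h2 that \<sigma> by simp
      moreover have "A * \<sigma> ^ k * half_line_moment 2 k = nth_deriv a b k g c * (gamma_coeff a k c / 2)"
        unfolding gamma_coeff_eq[OF \<sigma>_def, symmetric] by (simp add: A_def)
      ultimately show ?thesis
        by (simp only:) simp
    qed
    show ?thesis
      using I(2) unfolding e2 by (simp only: m cong: imp_cong)
  qed
  moreover have "\<exists>R. R \<in> O[at_top](\<lambda>t. t powr (- 2 - real k)) \<and>
         (\<forall>t>0. laplace_integral a b g h t =
           exp (t * h c) *
             (t powr (- 1 - real k) * nth_deriv a b k g c *
                h1 powi (- 1 - int k) * (- 1) ^ k * eta_coeff a c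
              + R t))" if c: "c = a \<or> c = b" and "h1 \<noteq> 0"
  proof -
    obtain M where "\<And>x. x \<in> {a..b} \<Longrightarrow> \<bar>h x - h c - h1 * (x - c)\<bar> \<le> M * \<bar>x - c\<bar> ^ 2"
      using times_cont_diff_linear_approx[OF h_2 assms(2)] unfolding h1_def by metis
    then have M: "\<bar>h x - h c - h1 * (x - c) ^ 1\<bar> \<le> M * \<bar>x - c\<bar> ^ (1 + 1)" if "x \<in> {a..b}" for x
      using that by (simp only: power_one_right one_add_one)
    note I = laplace_endpoint[OF assms(1) c \<sigma>_def order_refl cont assms(3) M B \<open>h1 \<noteq> 0\<close>]
    have \<sigma>: "\<sigma> = 1 \<or> \<sigma> = - 1" and \<eta>: "eta_coeff a c = - \<sigma>"
      by (auto simp: \<sigma>_def eta_coeff_def)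
    have e: "- (real k + 2) / real 1 = - 2 - real k"
      by simp
    have m: "A * \<sigma> ^ k * half_line_moment 1 k * (t * (- h1 * \<sigma> ^ 1)) powr (- (real k + 1) / real 1)
       = t powr (- 1 - real k) * nth_deriv a b k g c *
           h1 powi (- 1 - int k) * (- 1) ^ k * eta_coeff a c" if t: "t > 0" for t
    proof -
      \<comment> \<open>\<open>h1\<close> and \<open>\<sigma>\<close> have opposite signs, so this
        base is positive and \<open>powr\<close> agrees with the ordinary power, even where
        \<open>h1\<close> is negative.\<close>
      have "0 < - h1 * \<sigma>"
        using I(1) by simp
      then have "(- h1 * \<sigma>) powr real (k + 1) = (- h1 * \<sigma>) ^ (k + 1)"
        by (rule powr_realpow)
      then have "(- h1 * \<sigma>) powr (- (real k + 1)) = inverse ((- h1 * \<sigma>) ^ (k + 1))"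
        by (simp only: powr_minus of_nat_add of_nat_1)
      also have "\<dots> = inverse (h1 ^ (k + 1)) * (- \<sigma>) ^ (k + 1)"
        using \<sigma> by (auto simp: power_minus[of "inverse h1"] simp flip: power_inverse)
      also have "inverse (h1 ^ (k + 1)) = h1 powi (- 1 - int k)"
        by (simp add: power_int_def nat_add_distrib power_inverse)
      \<comment> \<open>Since \<open>\<sigma> ^ (2 * k) = 1\<close>, the signs collapse:
        \<open>\<sigma> ^ k * (- \<sigma>) ^ (k + 1) = (- 1) ^ k * - \<sigma>\<close>, and
        \<open>- \<sigma>\<close> is \<open>eta_coeff a c\<close>.\<close>
      finally have 1: "\<sigma> ^ k * (- h1 * \<sigma>) powr (- (real k + 1)) = h1 powi (- 1 - int k) * (- 1) ^ k * - \<sigma>"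
        using \<sigma> by auto
      have 2: "(t * (- h1 * \<sigma> ^ 1)) powr (- (real k + 1) / real 1) = t powr (- 1 - real k) * (- h1 * \<sigma>) powr (- (real k + 1))"
      proof -
        have "- (real k + 1) = - 1 - real k"
          by simp
        then show ?thesis
          by (simp only: powr_mult power_one_right of_nat_1 div_by_1)
      qed
      \<comment> \<open>The moment is \<open>fact k\<close> and cancels the factorial in
        \<open>A\<close>.\<close>
      have 3: "A * half_line_moment 1 k = nth_deriv a b k g c"
        by (simp add: A_def half_line_moment_1 del: One_nat_def)
      have "A * \<sigma> ^ k * half_line_moment 1 k * (t * (- h1 * \<sigma> ^ 1)) powr (- (real k + 1) / real 1)
          = t powr (- 1 - real k) * (A * half_line_moment 1 k) * (\<sigma> ^ k * (- h1 * \<sigma>) powr (- (real k + 1)))"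
        unfolding 2 by (simp only: mult_ac)
      then show ?thesis
        unfolding 1 3 \<eta> by (simp only: mult.assoc)
    qed
    show ?thesis
      using I(2) unfolding e by (simp only: m cong: imp_cong)
  qed
  ultimately show ?thesis
    unfolding h1_def h2_def by blast
qed

end
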